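(* Let $t_1,t_2,t_3,m_1,m_2,m_3$ be non-zero complex numbers with $t_i\neq1$ and $m_i\ne1$ for all $1\le i\le 3$. The tensor product representation $\hat{\phi}_G(t_1,t_2,t_3)\otimes\hat{\phi}_G(m_1,m_2,m_3)$ of $Cb_3$ on $\mathbb{C}^2\otimes\mathbb{C}^2$ is irreducible if and only if $(t_1,t_2,t_3)$ and $(m_1,m_2,m_3)$ are distinct vectors.
   Context: Let $\mathbb{F}_3$ be the free group on $x_1,x_2,x_3$. The group $Cb_3$ of basis conjugating automorphisms is the subgroup of $\mathrm{Aut}(\mathbb{F}_3)$ of all automorphisms $\phi$ such that for each $i$, $\phi(x_i)=f_i^{-1}x_if_i$ for some $f_i\in\mathbb{F}_3$. It is generated (McCool) by the automorphisms $\epsilon_{ij}$, $1\le i\ne j\le 3$, where $\epsilon_{ij}(x_i)=x_j^{-1}x_ix_j$ and $\epsilon_{ij}(x_l)=x_l$ for $l\ne i$. Products of automorphisms are taken in the right-action convention: $\phi\psi$ means first apply $\phi$, then $\psi$. For non-zero complex numbers $t_1,t_2,t_3$ with $t_3\neq 1$, $\hat{\phi}_G(t_1,t_2,t_3):Cb_3\to GL_2(\mathbb{C})$ is the homomorphism given on generators (matrices acting on column vectors from the left) by $$\epsilon_{12}\mapsto\begin{pmatrix}t_2^{-1}&t_2^{-1}(t_1-1)\\0&1\end{pmatrix},\quad \epsilon_{21}\mapsto\begin{pmatrix}1&0\\t_1^{-1}(t_2-1)&t_1^{-1}\end{pmatrix},\quad \epsilon_{13}\mapsto\begin{pmatrix}t_3^{-1}&0\\0&1\end{pmatrix},$$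 $$\epsilon_{31}\mapsto\begin{pmatrix}t_1^{-1}&0\\-t_1^{-1}(t_2-1)&1\end{pmatrix},\quad \epsilon_{32}\mapsto\begin{pmatrix}1&-t_2^{-1}(t_1-1)\\0&t_2^{-1}\end{pmatrix},\quad \epsilon_{23}\mapsto\begin{pmatrix}1&0\\0&t_3^{-1}\end{pmatrix}.$$ (These assignments do define a homomorphism. It arises as the action on $\mathbb{C}^3/\langle (t_1-1,t_2-1,t_3-1)^T\rangle$ induced by the representation sending $\epsilon_{ij}$ to the $3\times3$ matrix that agrees with the identity except in row $i$, which has $(i,i)$ entry $t_j^{-1}$, $(i,j)$ entry $t_j^{-1}(t_i-1)$ and zero otherwise.) The tensor product representation sends $g$ to $\hat{\phi}_G(t_1,t_2,t_3)(g)\otimes\hat{\phi}_G(m_1,m_2,m_3)(g)$. Irreducible means that the only subspaces of the representation space invariant under the whole group are $0$ and the whole space. *)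

theory Defs
  imports "HOL-Analysis.Analysis" "HOL-Algebra.Bij"
begin

text \<open>The letter \<open>(a, True)\<close> stands for the generator \<open>a\<close> and \<open>(a, False)\<close> for its inverse.
  Elements of the free group are the freely reduced words; \<open>lcons\<close> multiplies a reduced word
  by a letter from the left.\<close>

type_synonym 'a word = "('a \<times> bool) list"

definition inv_letter :: "'a \<times> bool \<Rightarrow> 'a \<times> bool" where
  "inv_letter l = (fst l, \<not> snd l)"

definition reduced :: "'a word \<Rightarrow> bool" where
  "reduced w \<longleftrightarrow> successively (\<lambda>l l'. l' \<noteq> inv_letter l) w"

fun lcons :: "'a \<times> bool \<Rightarrow> 'a word \<Rightarrow> 'a word" where
  "lcons l [] = [l]"
| "lcons l (l' # w) = (if l' = inv_letter l then w else l # l' # w)"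

definition free_group :: "'a set \<Rightarrow> 'a word monoid" where
  "free_group S =
    \<lparr>carrier = {w. fst ` set w \<subseteq> S \<and> reduced w},
     mult = (\<lambda>v w. foldr lcons v w),
     one = []\<rparr>"

definition gen :: "'a \<Rightarrow> 'a word" where
  "gen a = [(a, True)]"

text \<open>The homomorphism out of a free group with prescribed values \<open>f\<close> on the generators.\<close>

definition free_ext :: "('b, 'c) monoid_scheme \<Rightarrow> ('a \<Rightarrow> 'b) \<Rightarrow> 'a word \<Rightarrow> 'b" where
  "free_ext G f w =
     foldr (\<lambda>(a, b) y. (if b then f a else inv\<^bsub>G\<^esub> (f a)) \<otimes>\<^bsub>G\<^esub> y) w \<one>\<^bsub>G\<^esub>"

abbreviation F3 :: "nat word monoid" where
  "F3 \<equiv> free_group {1, 2, 3}"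

text \<open>The product \<open>\<phi> \<psi>\<close> is \<open>\<phi>\<close> followed by \<open>\<psi>\<close>, opposite to the convention of \<^const>\<open>AutoGroup\<close>.\<close>

definition Cb3 :: "(nat word \<Rightarrow> nat word) monoid" where
  "Cb3 =
    \<lparr>carrier = {\<phi> \<in> auto F3. \<forall>i\<in>{1, 2, 3}. \<exists>f\<in>carrier F3.
        \<phi> (gen i) = inv\<^bsub>F3\<^esub> f \<otimes>\<^bsub>F3\<^esub> gen i \<otimes>\<^bsub>F3\<^esub> f},
     mult = (\<lambda>\<phi> \<psi>. compose (carrier F3) \<psi> \<phi>),
     one = (\<lambda>w\<in>carrier F3. w)\<rparr>"

definition eps :: "nat \<Rightarrow> nat \<Rightarrow> nat word \<Rightarrow> nat word" where
  "eps i j = (\<lambda>w\<in>carrier F3. free_ext F3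
     (\<lambda>l. if l = i then inv\<^bsub>F3\<^esub> (gen j) \<otimes>\<^bsub>F3\<^esub> gen i \<otimes>\<^bsub>F3\<^esub> gen j else gen l) w)"

definition GL :: "(complex ^ 'n ^ 'n) monoid" where
  "GL = \<lparr>carrier = {A. invertible A}, mult = (**), one = mat 1\<rparr>"

definition mat22 :: "complex \<Rightarrow> complex \<Rightarrow> complex \<Rightarrow> complex \<Rightarrow> complex ^ 2 ^ 2" where
  "mat22 a b c d = vector [vector [a, b], vector [c, d]]"

definition is_phi_hat ::
  "complex \<Rightarrow> complex \<Rightarrow> complex \<Rightarrow> ((nat word \<Rightarrow> nat word) \<Rightarrow> complex ^ 2 ^ 2) \<Rightarrow> bool" where
  "is_phi_hat t1 t2 t3 \<rho> \<longleftrightarrow>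
     \<rho> \<in> hom Cb3 GL \<and>
     \<rho> (eps 1 2) = mat22 (inverse t2) (inverse t2 * (t1 - 1)) 0 1 \<and>
     \<rho> (eps 2 1) = mat22 1 0 (inverse t1 * (t2 - 1)) (inverse t1) \<and>
     \<rho> (eps 1 3) = mat22 (inverse t3) 0 0 1 \<and>
     \<rho> (eps 3 1) = mat22 (inverse t1) 0 (- inverse t1 * (t2 - 1)) 1 \<and>
     \<rho> (eps 3 2) = mat22 1 (- inverse t2 * (t1 - 1)) 0 (inverse t2) \<and>
     \<rho> (eps 2 3) = mat22 1 0 0 (inverse t3)"

text \<open>Existence is lemma \<open>is_phi_hat_phi_hat\<close> below. On the carrier of \<^const>\<open>Cb3\<close> the choice is
  unique, because the \<^const>\<open>eps\<close> generate the group (McCool).\<close>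

definition phi_hat ::
  "complex \<Rightarrow> complex \<Rightarrow> complex \<Rightarrow> (nat word \<Rightarrow> nat word) \<Rightarrow> complex ^ 2 ^ 2" where
  "phi_hat t1 t2 t3 = (SOME \<rho>. is_phi_hat t1 t2 t3 \<rho>)"

text \<open>The tensor product of the coordinate spaces indexed by \<open>'n\<close> and \<open>'m\<close> is the coordinate space
  indexed by pairs, \<open>e\<^sub>i \<otimes> e\<^sub>k\<close> being the basis vector at \<open>(i, k)\<close>; the tensor product of two
  linear maps is then the Kronecker product of their matrices.\<close>

definition kronecker ::
  "complex ^ 'n ^ 'n \<Rightarrow> complex ^ 'm ^ 'm \<Rightarrow> complex ^ ('n \<times> 'm) ^ ('n \<times> 'm)" where
  "kronecker A B = (\<chi> p q. A $ fst p $ fst q * B $ snd p $ snd q)"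

definition tensor_rep ::
  "('g \<Rightarrow> complex ^ 'n ^ 'n) \<Rightarrow> ('g \<Rightarrow> complex ^ 'm ^ 'm) \<Rightarrow> 'g \<Rightarrow> complex ^ ('n \<times> 'm) ^ ('n \<times> 'm)"
  where "tensor_rep \<rho> \<sigma> g = kronecker (\<rho> g) (\<sigma> g)"

text \<open>\<^const>\<open>vec.subspace\<close> is the notion of complex subspace; plain \<^const>\<open>subspace\<close> would
  only be real.\<close>

definition irreducible_rep ::
  "('g, 'b) monoid_scheme \<Rightarrow> ('g \<Rightarrow> complex ^ 'n ^ 'n) \<Rightarrow> bool" where
  "irreducible_rep G \<rho> \<longleftrightarrow>
     (\<forall>W. vec.subspace W \<and> (\<forall>g\<in>carrier G. \<forall>w\<in>W. \<rho> g *v w \<in> W) \<longrightarrow> W = {0} \<or> W = UNIV)"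

lemma inv_letter_simps [simp]:
  "inv_letter (inv_letter l) = l" "fst (inv_letter l) = fst l"
  "inv_letter l \<noteq> l" "l \<noteq> inv_letter l"
  by (auto simp: inv_letter_def prod_eq_iff)

lemma inv_letter_eq_iff: "l = inv_letter l' \<longleftrightarrow> l' = inv_letter l"
  by (auto simp: inv_letter_def prod_eq_iff)

lemma reduced_simps [simp]:
  "reduced []" "reduced [l]"
  "reduced (l # l' # w) \<longleftrightarrow> l' \<noteq> inv_letter l \<and> reduced (l' # w)"
  by (auto simp: reduced_def)

lemma reduced_ConsD: "reduced (l # w) \<Longrightarrow> reduced w"
  by (cases w) auto

lemma lcons_reduced: "reduced (l # w) \<Longrightarrow> lcons l w = l # w"
  by (cases w) auto

lemma reduced_lcons: "reduced w \<Longrightarrow> reduced (lcons l w)"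
  by (cases w) (auto dest: reduced_ConsD)

lemma lcons_inv [simp]: "reduced w \<Longrightarrow> lcons l (lcons (inv_letter l) w) = w"
  by (cases w) (auto simp: lcons_reduced)

lemma lcons_inv' [simp]: "reduced w \<Longrightarrow> lcons (inv_letter l) (lcons l w) = w"
  using lcons_inv[of w "inv_letter l"] by simp

lemma set_lcons: "set (lcons l w) \<subseteq> insert l (set w)"
  by (cases w) auto

lemma reduced_foldr_lcons: "reduced w \<Longrightarrow> reduced (foldr lcons v w)"
  by (induction v) (auto intro: reduced_lcons)

lemma set_foldr_lcons: "set (foldr lcons v w) \<subseteq> set v \<union> set w"
proof (induction v)
  case (Cons l v)
  then show ?case using set_lcons[of l "foldr lcons v w"] by auto
qed simp

lemma foldr_lcons_lcons:
  "reduced w \<Longrightarrow> foldr lcons (lcons l v) w = lcons l (foldr lcons v w)"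
  by (cases v) (auto simp: reduced_foldr_lcons)

lemma foldr_lcons_assoc:
  "reduced w \<Longrightarrow> foldr lcons (foldr lcons u v) w = foldr lcons u (foldr lcons v w)"
  by (induction u) (auto simp: foldr_lcons_lcons)

lemma foldr_lcons_Nil: "reduced w \<Longrightarrow> foldr lcons w [] = w"
proof (induction w)
  case (Cons l w)
  then show ?case by (simp add: lcons_reduced reduced_ConsD)
qed simp

lemma foldr_lcons_inverse:
  "reduced w \<Longrightarrow> foldr lcons (rev (map inv_letter v)) (foldr lcons v w) = w"
  by (induction v arbitrary: w) (auto simp: reduced_foldr_lcons)

lemma reduced_inverse: "reduced w \<Longrightarrow> reduced (rev (map inv_letter w))"
proof -
  assume "reduced w"
  then have "successively (\<lambda>l l'. inv_letter l \<noteq> l') w"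
    unfolding reduced_def by (rule successively_mono) auto
  then show ?thesis
    unfolding reduced_def successively_rev successively_map by simp
qed

lemma carrier_free_group: "w \<in> carrier (free_group S) \<longleftrightarrow> fst ` set w \<subseteq> S \<and> reduced w"
  by (simp add: free_group_def)

lemma mult_free_group: "v \<otimes>\<^bsub>free_group S\<^esub> w = foldr lcons v w"
  by (simp add: free_group_def)

lemma one_free_group: "\<one>\<^bsub>free_group S\<^esub> = []"
  by (simp add: free_group_def)

lemmas free_group_simps = carrier_free_group mult_free_group one_free_group

lemma group_free_group: "group (free_group S)"
proof (rule groupI)
  fix v w assume "v \<in> carrier (free_group S)" "w \<in> carrier (free_group S)"
  then show "v \<otimes>\<^bsub>free_group S\<^esub> w \<in> carrier (free_group S)"
    using set_foldr_lcons[of v w] by (fastforce simp: free_group_simps reduced_foldr_lcons)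
next
  fix w assume w: "w \<in> carrier (free_group S)"
  have "rev (map inv_letter w) \<in> carrier (free_group S)"
    using w by (auto simp: carrier_free_group reduced_inverse image_image)
  moreover have "rev (map inv_letter w) \<otimes>\<^bsub>free_group S\<^esub> w = \<one>\<^bsub>free_group S\<^esub>"
    using w foldr_lcons_inverse[of "[]" w] by (simp add: free_group_simps foldr_lcons_Nil)
  ultimately show "\<exists>v\<in>carrier (free_group S). v \<otimes>\<^bsub>free_group S\<^esub> w = \<one>\<^bsub>free_group S\<^esub>"
    by blast
qed (auto simp: free_group_simps foldr_lcons_assoc)

lemma gen_closed [simp]: "a \<in> S \<Longrightarrow> gen a \<in> carrier (free_group S)"
  by (simp add: carrier_free_group gen_def)

lemma inv_gen: "a \<in> S \<Longrightarrow> inv\<^bsub>free_group S\<^esub> (gen a) = [(a, False)]"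
  by (rule group.inv_equality[OF group_free_group])
     (auto simp: free_group_simps gen_def inv_letter_def)

lemma free_ext_Nil [simp]: "free_ext G f [] = \<one>\<^bsub>G\<^esub>"
  by (simp add: free_ext_def)

lemma free_ext_Cons [simp]:
  "free_ext G f ((a, b) # w) = (if b then f a else inv\<^bsub>G\<^esub> (f a)) \<otimes>\<^bsub>G\<^esub> free_ext G f w"
  by (simp add: free_ext_def)

lemma free_ext_closed:
  assumes "group G" "f \<in> S \<rightarrow> carrier G" "fst ` set w \<subseteq> S"
  shows "free_ext G f w \<in> carrier G"
proof -
  interpret group G by fact
  show ?thesis using assms(3)
  proof (induction w)
    case (Cons l w)
    then have "f (fst l) \<in> carrier G" using assms(2) by auto
    with Cons show ?case by (cases l) auto
  qed simp
qed

lemma free_ext_lcons: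
  assumes "group G" "f \<in> S \<rightarrow> carrier G" "fst ` set w \<subseteq> S" "a \<in> S"
  shows "free_ext G f (lcons (a, b) w) = free_ext G f ((a, b) # w)"
proof -
  interpret group G by fact
  have fa: "f a \<in> carrier G" using assms by auto
  show ?thesis
  proof (cases w)
    case (Cons l' w')
    then have "free_ext G f w' \<in> carrier G"
      using free_ext_closed[of G f S w'] assms by auto
    then show ?thesis using Cons fa
      by (auto simp: inv_letter_def m_assoc[symmetric])
  qed simp
qed

lemma free_ext_hom:
  assumes G: "group G" and f: "f \<in> S \<rightarrow> carrier G"
  shows "free_ext G f \<in> hom (free_group S) G"
proof (rule homI)
  interpret group G by fact
  fix v w assume v: "v \<in> carrier (free_group S)" and w: "w \<in> carrier (free_group S)"
  have "fst ` set v \<subseteq> S" "fst ` set w \<subseteq> S" using v w by (auto simp: carrier_free_group)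
  then have "free_ext G f (foldr lcons v w) = free_ext G f v \<otimes>\<^bsub>G\<^esub> free_ext G f w"
  proof (induction v)
    case Nil
    then show ?case using free_ext_closed[OF G f] by simp
  next
    case (Cons l v)
    obtain a b where l: "l = (a, b)" by force
    have fa: "f a \<in> carrier G" using Cons.prems l f by auto
    have "fst ` set (foldr lcons v w) \<subseteq> S"
      using Cons.prems set_foldr_lcons[of v w] by fastforce
    then have "free_ext G f (foldr lcons (l # v) w) = free_ext G f (l # foldr lcons v w)"
      using free_ext_lcons[OF G f] Cons.prems l by auto
    moreover have "free_ext G f v \<in> carrier G" "free_ext G f w \<in> carrier G"
      using Cons.prems free_ext_closed[OF G f] by auto
    ultimately show ?case using Cons l fa by (auto simp: m_assoc)
  qed
  then show "free_ext G f (v \<otimes>\<^bsub>free_group S\<^esub> w) = free_ext G f v \<otimes>\<^bsub>G\<^esub> free_ext G f w"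
    by (simp add: mult_free_group)
qed (use free_ext_closed[OF G f] in \<open>auto simp: carrier_free_group\<close>)

lemma free_ext_gen: "group G \<Longrightarrow> f a \<in> carrier G \<Longrightarrow> free_ext G f (gen a) = f a"
  by (simp add: gen_def group.is_monoid)

lemma hom_free_group_eqI:
  assumes "group G" "h \<in> hom (free_group S) G" "k \<in> hom (free_group S) G"
    and eq: "\<And>a. a \<in> S \<Longrightarrow> h (gen a) = k (gen a)" and w: "w \<in> carrier (free_group S)"
  shows "h w = k w"
proof -
  interpret F: group "free_group S" by (rule group_free_group)
  interpret h: group_hom "free_group S" G h
    using assms group_free_group by (simp add: group_hom_def group_hom_axioms_def)
  interpret k: group_hom "free_group S" G k
    using assms group_free_group by (simp add: group_hom_def group_hom_axioms_def)
  show ?thesis using w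
  proof (induction w)
    case Nil
    then show ?case using h.hom_one k.hom_one by (simp add: one_free_group)
  next
    case (Cons l w)
    obtain a b where l: "l = (a, b)" by force
    have a: "a \<in> S" and w: "w \<in> carrier (free_group S)"
      using Cons.prems l by (auto simp: carrier_free_group dest: reduced_ConsD)
    have lc: "[l] \<in> carrier (free_group S)" using a l by (simp add: carrier_free_group)
    have "h [l] = k [l]"
    proof (cases b)
      case True
      then show ?thesis using eq[OF a] l by (simp add: gen_def)
    next
      case False
      then have "[l] = inv\<^bsub>free_group S\<^esub> (gen a)" using l a by (simp add: inv_gen)
      then show ?thesis using a eq[OF a] by simp
    qed
    moreover have "l # w = [l] \<otimes>\<^bsub>free_group S\<^esub> w"
      using Cons.prems by (simp add: free_group_simps lcons_reduced)
    ultimately show ?case using Cons.IH w lc by simp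
  qed
qed

declare One_nat_def [simp del]

interpretation F3: group F3
  by (rule group_free_group)

lemma F3_cancel:
  assumes "v \<in> carrier F3" "w \<in> carrier F3"
  shows "inv\<^bsub>F3\<^esub> v \<otimes>\<^bsub>F3\<^esub> (v \<otimes>\<^bsub>F3\<^esub> w) = w" "v \<otimes>\<^bsub>F3\<^esub> (inv\<^bsub>F3\<^esub> v \<otimes>\<^bsub>F3\<^esub> w) = w"
  using assms by (simp_all flip: F3.m_assoc)

lemma Cb3_carrier:
  "\<phi> \<in> carrier Cb3 \<longleftrightarrow> \<phi> \<in> auto F3 \<and> (\<forall>i\<in>{1, 2, 3}. \<exists>f\<in>carrier F3.
     \<phi> (gen i) = inv\<^bsub>F3\<^esub> f \<otimes>\<^bsub>F3\<^esub> gen i \<otimes>\<^bsub>F3\<^esub> f)"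
  by (simp add: Cb3_def)

lemma Cb3_mult: "\<phi> \<otimes>\<^bsub>Cb3\<^esub> \<psi> = compose (carrier F3) \<psi> \<phi>"
  by (simp add: Cb3_def)

lemma Cb3_one: "\<one>\<^bsub>Cb3\<^esub> = (\<lambda>w\<in>carrier F3. w)"
  by (simp add: Cb3_def)

lemma Cb3_hom: "\<phi> \<in> carrier Cb3 \<Longrightarrow> group_hom F3 F3 \<phi>"
  using group_free_group by (auto simp: Cb3_carrier auto_def group_hom_def group_hom_axioms_def)

lemma group_Cb3: "group Cb3"
proof (rule groupI)
  fix \<phi> \<psi> assume \<phi>: "\<phi> \<in> carrier Cb3" and \<psi>: "\<psi> \<in> carrier Cb3"
  interpret p: group_hom F3 F3 \<phi> by (rule Cb3_hom[OF \<phi>])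
  interpret q: group_hom F3 F3 \<psi> by (rule Cb3_hom[OF \<psi>])
  have "compose (carrier F3) \<psi> \<phi> \<in> auto F3"
    using \<phi> \<psi> by (auto simp: Cb3_carrier auto_def hom_compose compose_Bij)
      (auto simp: hom_def compose_def)
  moreover have "\<exists>f\<in>carrier F3. compose (carrier F3) \<psi> \<phi> (gen i)
      = inv\<^bsub>F3\<^esub> f \<otimes>\<^bsub>F3\<^esub> gen i \<otimes>\<^bsub>F3\<^esub> f" if i: "i \<in> {1, 2, 3}" for i
  proof -
    obtain f g where f: "f \<in> carrier F3" "\<phi> (gen i) = inv\<^bsub>F3\<^esub> f \<otimes>\<^bsub>F3\<^esub> gen i \<otimes>\<^bsub>F3\<^esub> f"
      and g: "g \<in> carrier F3" "\<psi> (gen i) = inv\<^bsub>F3\<^esub> g \<otimes>\<^bsub>F3\<^esub> gen i \<otimes>\<^bsub>F3\<^esub> g"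
      using \<phi> \<psi> i unfolding Cb3_carrier by blast
    have gi: "gen i \<in> carrier F3" using i by (rule gen_closed)
    have "compose (carrier F3) \<psi> \<phi> (gen i)
        = inv\<^bsub>F3\<^esub> (g \<otimes>\<^bsub>F3\<^esub> \<psi> f) \<otimes>\<^bsub>F3\<^esub> gen i \<otimes>\<^bsub>F3\<^esub> (g \<otimes>\<^bsub>F3\<^esub> \<psi> f)"
      using f g gi by (simp add: compose_def F3.inv_mult_group F3.m_assoc)
    then show ?thesis using f g by (meson F3.m_closed q.hom_closed)
  qed
  ultimately show "\<phi> \<otimes>\<^bsub>Cb3\<^esub> \<psi> \<in> carrier Cb3"
    unfolding Cb3_mult unfolding Cb3_carrier by blast
next
  have "(\<lambda>w\<in>carrier F3. w) \<in> auto F3"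
    by (auto simp: auto_def id_Bij hom_def)
  moreover have "\<exists>f\<in>carrier F3. (\<lambda>w\<in>carrier F3. w) (gen i)
      = inv\<^bsub>F3\<^esub> f \<otimes>\<^bsub>F3\<^esub> gen i \<otimes>\<^bsub>F3\<^esub> f" if i: "i \<in> {1, 2, 3}" for i
    using gen_closed[OF i] by (intro bexI[of _ "\<one>\<^bsub>F3\<^esub>"]) auto
  ultimately show "\<one>\<^bsub>Cb3\<^esub> \<in> carrier Cb3"
    unfolding Cb3_one unfolding Cb3_carrier by blast
next
  fix \<phi> \<psi> \<theta> assume "\<phi> \<in> carrier Cb3" "\<psi> \<in> carrier Cb3" "\<theta> \<in> carrier Cb3"
  then show "\<phi> \<otimes>\<^bsub>Cb3\<^esub> \<psi> \<otimes>\<^bsub>Cb3\<^esub> \<theta> = \<phi> \<otimes>\<^bsub>Cb3\<^esub> (\<psi> \<otimes>\<^bsub>Cb3\<^esub> \<theta>)"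
    by (auto simp: Cb3_mult compose_def restrict_def fun_eq_iff Cb3_carrier auto_def hom_def)
next
  fix \<phi> assume \<phi>: "\<phi> \<in> carrier Cb3"
  then show "\<one>\<^bsub>Cb3\<^esub> \<otimes>\<^bsub>Cb3\<^esub> \<phi> = \<phi>"
    by (auto simp: Cb3_mult Cb3_one Cb3_carrier auto_def Bij_def extensional_def compose_def
        restrict_def fun_eq_iff)
next
  fix \<phi> assume \<phi>: "\<phi> \<in> carrier Cb3"
  define \<psi> where "\<psi> = (\<lambda>w\<in>carrier F3. inv_into (carrier F3) \<phi> w)"
  have bij: "\<phi> \<in> Bij (carrier F3)" and hom: "\<phi> \<in> hom F3 F3"
    using \<phi> by (auto simp: Cb3_carrier auto_def)
  then have bb: "bij_betw \<phi> (carrier F3) (carrier F3)" by (simp add: Bij_def)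
  have \<psi>_bij: "\<psi> \<in> Bij (carrier F3)"
    unfolding \<psi>_def by (rule restrict_inv_into_Bij[OF bij])
  have \<psi>_hom: "\<psi> \<in> hom F3 F3"
  proof -
    have "inv_into (carrier F3) \<phi> \<in> hom F3 F3"
      using F3.iso_set_sym[of \<phi> F3] hom bb by (auto simp: iso_def)
    then show ?thesis unfolding \<psi>_def by (auto simp: hom_def)
  qed
  interpret p: group_hom F3 F3 \<phi> by (rule Cb3_hom[OF \<phi>])
  interpret q: group_hom F3 F3 \<psi>
    by (rule group_hom.intro; (rule F3.is_group)?; (rule group_hom_axioms.intro)?; rule \<psi>_hom)
  have \<phi>\<psi>: "\<phi> (\<psi> w) = w" and \<psi>\<phi>: "\<psi> (\<phi> w) = w" if "w \<in> carrier F3" for w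
    using that bb p.hom_closed
    by (auto simp: \<psi>_def bij_betw_def f_inv_into_f inv_into_f_f)
  have "\<exists>f\<in>carrier F3. \<psi> (gen i) = inv\<^bsub>F3\<^esub> f \<otimes>\<^bsub>F3\<^esub> gen i \<otimes>\<^bsub>F3\<^esub> f"
    if i: "i \<in> {1, 2, 3}" for i
  proof -
    obtain f where f: "f \<in> carrier F3" "\<phi> (gen i) = inv\<^bsub>F3\<^esub> f \<otimes>\<^bsub>F3\<^esub> gen i \<otimes>\<^bsub>F3\<^esub> f"
      using \<phi> i unfolding Cb3_carrier by blast
    have gi: "gen i \<in> carrier F3" using i by (rule gen_closed)
    have "f \<otimes>\<^bsub>F3\<^esub> \<phi> (gen i) \<otimes>\<^bsub>F3\<^esub> inv\<^bsub>F3\<^esub> f = gen i"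
      using f gi by (simp add: F3.m_assoc F3_cancel)
    then have "\<psi> (gen i) = \<psi> (f \<otimes>\<^bsub>F3\<^esub> \<phi> (gen i) \<otimes>\<^bsub>F3\<^esub> inv\<^bsub>F3\<^esub> f)" by simp
    also have "\<dots> = inv\<^bsub>F3\<^esub> (inv\<^bsub>F3\<^esub> \<psi> f) \<otimes>\<^bsub>F3\<^esub> gen i \<otimes>\<^bsub>F3\<^esub> (inv\<^bsub>F3\<^esub> \<psi> f)"
      using f(1) gi by (simp add: \<psi>\<phi>)
    finally show ?thesis using f by (meson F3.inv_closed q.hom_closed)
  qed
  then have "\<psi> \<in> carrier Cb3"
    unfolding Cb3_carrier auto_def using \<psi>_hom \<psi>_bij by blast
  moreover have "\<psi> \<otimes>\<^bsub>Cb3\<^esub> \<phi> = \<one>\<^bsub>Cb3\<^esub>"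
    by (auto simp: Cb3_mult Cb3_one compose_def restrict_def \<phi>\<psi>)
  ultimately show "\<exists>\<psi>\<in>carrier Cb3. \<psi> \<otimes>\<^bsub>Cb3\<^esub> \<phi> = \<one>\<^bsub>Cb3\<^esub>" by blast
qed

lemma eps_hom:
  assumes "i \<in> {1, 2, 3}" "j \<in> {1, 2, 3}"
  shows "eps i j \<in> hom F3 F3"
proof -
  have "free_ext F3 (\<lambda>l. if l = i then inv\<^bsub>F3\<^esub> (gen j) \<otimes>\<^bsub>F3\<^esub> gen i \<otimes>\<^bsub>F3\<^esub> gen j else gen l)
      \<in> hom F3 F3"
    by (rule free_ext_hom[OF group_free_group])
       (use gen_closed[OF assms(1)] gen_closed[OF assms(2)] in auto)
  then show ?thesis unfolding eps_def by (auto simp: hom_def)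
qed

lemma eps_gen:
  assumes "i \<in> {1, 2, 3}" "j \<in> {1, 2, 3}" "l \<in> {1, 2, 3}"
  shows "eps i j (gen l) =
    (if l = i then inv\<^bsub>F3\<^esub> (gen j) \<otimes>\<^bsub>F3\<^esub> gen i \<otimes>\<^bsub>F3\<^esub> gen j else gen l)"
  using gen_closed[OF assms(1)] gen_closed[OF assms(2)] gen_closed[OF assms(3)]
  unfolding eps_def by (auto simp: free_ext_gen[OF group_free_group])

lemma eps_Cb3:
  assumes ij: "i \<in> {1, 2, 3}" "j \<in> {1, 2, 3}" "i \<noteq> j"
  shows "eps i j \<in> carrier Cb3"
proof -
  note gi = gen_closed[OF ij(1)] and gj = gen_closed[OF ij(2)]
  define h where "h = free_ext F3
    (\<lambda>l. if l = i then gen j \<otimes>\<^bsub>F3\<^esub> gen i \<otimes>\<^bsub>F3\<^esub> inv\<^bsub>F3\<^esub> (gen j) else gen l)"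
  have h: "h \<in> hom F3 F3"
    unfolding h_def by (rule free_ext_hom[OF group_free_group]) (use gi gj in auto)
  have h_gen: "h (gen l) = (if l = i then gen j \<otimes>\<^bsub>F3\<^esub> gen i \<otimes>\<^bsub>F3\<^esub> inv\<^bsub>F3\<^esub> (gen j) else gen l)"
    if "l \<in> {1, 2, 3}" for l
    using gi gj gen_closed[OF that] unfolding h_def by (auto simp: free_ext_gen[OF group_free_group])
  note e = eps_hom[OF ij(1,2)] and e_gen = eps_gen[OF ij(1,2)]
  interpret h: group_hom F3 F3 h
    by (rule group_hom.intro; (rule F3.is_group)?; (rule group_hom_axioms.intro)?; rule h)
  interpret e: group_hom F3 F3 "eps i j"
    by (rule group_hom.intro; (rule F3.is_group)?; (rule group_hom_axioms.intro)?; rule e)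
  have id: "id \<in> hom F3 F3" by (auto simp: hom_def)
  have "(h \<circ> eps i j) w = id w" if "w \<in> carrier F3" for w
  proof (rule hom_free_group_eqI[OF group_free_group hom_compose[OF e h] id _ that])
    fix l :: nat assume l: "l \<in> {1, 2, 3}"
    show "(h \<circ> eps i j) (gen l) = id (gen l)"
      using gi gj ij gen_closed[OF l] h_gen[OF ij(1)] h_gen[OF ij(2)] h_gen[OF l] e_gen[OF l]
      by (auto simp: F3.m_assoc F3_cancel)
  qed
  moreover have "(eps i j \<circ> h) w = id w" if "w \<in> carrier F3" for w
  proof (rule hom_free_group_eqI[OF group_free_group hom_compose[OF h e] id _ that])
    fix l :: nat assume l: "l \<in> {1, 2, 3}"
    show "(eps i j \<circ> h) (gen l) = id (gen l)"
      using gi gj ij gen_closed[OF l] h_gen[OF l] e_gen[OF ij(1)] e_gen[OF ij(2)] e_gen[OF l]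
      by (auto simp: F3.m_assoc F3_cancel)
  qed
  ultimately have "bij_betw (eps i j) (carrier F3) (carrier F3)"
    by (intro bij_betw_byWitness[where f' = h]) auto
  then have "eps i j \<in> auto F3"
    using e by (auto simp: auto_def Bij_def) (simp add: eps_def)
  moreover have "\<exists>f\<in>carrier F3. eps i j (gen l) = inv\<^bsub>F3\<^esub> f \<otimes>\<^bsub>F3\<^esub> gen l \<otimes>\<^bsub>F3\<^esub> f"
    if l: "l \<in> {1, 2, 3}" for l
    using e_gen[OF l] gj gen_closed[OF l]
    by (cases "l = i") (auto intro: bexI[of _ "gen j"] bexI[of _ "\<one>\<^bsub>F3\<^esub>"])
  ultimately show ?thesis unfolding Cb3_carrier by blast
qed

text \<open>\<open>fox t w k\<close> is the Fox derivative of \<open>w\<close> with respect to generator \<open>k\<close>, evaluated at \<open>t\<close>;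
  the derivatives of \<open>\<phi> (gen i)\<close> form the row \<open>i\<close> of the three-dimensional representation.\<close>

definition wlet :: "(nat \<Rightarrow> complex) \<Rightarrow> nat \<times> bool \<Rightarrow> complex" where
  "wlet t l = (if snd l then t (fst l) else inverse (t (fst l)))"

definition foxlet :: "(nat \<Rightarrow> complex) \<Rightarrow> nat \<times> bool \<Rightarrow> nat \<Rightarrow> complex" where
  "foxlet t l k = (if fst l = k then (if snd l then 1 else - inverse (t k)) else 0)"

fun weight :: "(nat \<Rightarrow> complex) \<Rightarrow> nat word \<Rightarrow> complex" where
  "weight t [] = 1"
| "weight t (l # w) = wlet t l * weight t w"

fun fox :: "(nat \<Rightarrow> complex) \<Rightarrow> nat word \<Rightarrow> nat \<Rightarrow> complex" where
  "fox t [] k = 0"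
| "fox t (l # w) k = foxlet t l k + wlet t l * fox t w k"

definition phi_hat_entry :: "(nat \<Rightarrow> complex) \<Rightarrow> (nat word \<Rightarrow> nat word) \<Rightarrow> nat \<Rightarrow> nat \<Rightarrow> complex" where
  "phi_hat_entry t \<phi> i j =
     fox t (\<phi> (gen i)) j - fox t (\<phi> (gen 3)) j * (t i - 1) / (t 3 - 1)"

definition phi_hat_matrix :: "(nat \<Rightarrow> complex) \<Rightarrow> (nat word \<Rightarrow> nat word) \<Rightarrow> complex ^ 2 ^ 2" where
  "phi_hat_matrix t \<phi> = mat22 (phi_hat_entry t \<phi> 1 1) (phi_hat_entry t \<phi> 1 2)
     (phi_hat_entry t \<phi> 2 1) (phi_hat_entry t \<phi> 2 2)"

lemma mat22_mult:
  "mat22 a b c d ** mat22 a' b' c' d' =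
   mat22 (a * a' + b * c') (a * b' + b * d') (c * a' + d * c') (c * b' + d * d')"
  by (simp add: mat22_def matrix_matrix_mult_def vec_eq_iff forall_2 sum_2)

lemma mat22_one: "mat22 1 0 0 1 = mat 1"
  by (simp add: mat22_def mat_def vec_eq_iff forall_2)

context
  fixes t :: "nat \<Rightarrow> complex"
  assumes t0: "\<And>a. t a \<noteq> 0" and t3: "t 3 \<noteq> 1"
begin

lemma wlet_inv: "wlet t l * wlet t (inv_letter l) = 1"
  using t0 by (auto simp: wlet_def inv_letter_def)

lemma fox_inv_letter: "foxlet t l k + wlet t l * foxlet t (inv_letter l) k = 0"
  using t0 by (auto simp: wlet_def foxlet_def inv_letter_def)

lemma weight_lcons: "weight t (lcons l w) = wlet t l * weight t w"
proof (cases w)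
  case (Cons l' w')
  then show ?thesis using wlet_inv[of l] by (auto simp flip: mult.assoc)
qed simp

lemma fox_lcons: "fox t (lcons l w) k = foxlet t l k + wlet t l * fox t w k"
proof (cases w)
  case (Cons l' w')
  have "foxlet t l k + wlet t l * (foxlet t (inv_letter l) k + wlet t (inv_letter l) * x) = x" for x
    using wlet_inv[of l] fox_inv_letter[of l k]
    by (metis (no_types, lifting) add.assoc add_0 distrib_left mult.assoc mult_1)
  then show ?thesis using Cons by auto
qed simp

lemma weight_mult: "weight t (v \<otimes>\<^bsub>F3\<^esub> w) = weight t v * weight t w"
  unfolding mult_free_group by (induction v) (auto simp: weight_lcons)

lemma fox_mult: "fox t (v \<otimes>\<^bsub>F3\<^esub> w) k = fox t v k + weight t v * fox t w k"
  unfolding mult_free_group by (induction v) (auto simp: fox_lcons algebra_simps)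

lemma weight_nz: "weight t w \<noteq> 0"
  using t0 by (induction w) (auto simp: wlet_def)

lemma weight_inv: "w \<in> carrier F3 \<Longrightarrow> weight t (inv\<^bsub>F3\<^esub> w) = inverse (weight t w)"
  using weight_mult[of "inv\<^bsub>F3\<^esub> w" w] weight_nz[of w]
  by (simp add: one_free_group field_simps)

lemma fox_inv: "w \<in> carrier F3 \<Longrightarrow> fox t (inv\<^bsub>F3\<^esub> w) k = - inverse (weight t w) * fox t w k"
  using fox_mult[of "inv\<^bsub>F3\<^esub> w" w k]
  by (simp add: one_free_group weight_inv eq_neg_iff_add_eq_0)

lemma weight_gen [simp]: "weight t (gen i) = t i"
  by (simp add: gen_def wlet_def)

lemma fox_gen [simp]: "fox t (gen i) k = (if i = k then 1 else 0)"
  by (simp add: gen_def foxlet_def)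

lemma weight_Cb3_gen: "\<phi> \<in> carrier Cb3 \<Longrightarrow> i \<in> {1, 2, 3} \<Longrightarrow> weight t (\<phi> (gen i)) = t i"
proof -
  assume "\<phi> \<in> carrier Cb3" "i \<in> {1, 2, 3}"
  then obtain f where "f \<in> carrier F3" "\<phi> (gen i) = inv\<^bsub>F3\<^esub> f \<otimes>\<^bsub>F3\<^esub> gen i \<otimes>\<^bsub>F3\<^esub> f"
    unfolding Cb3_carrier by blast
  then show ?thesis using weight_nz[of f] by (simp add: weight_mult weight_inv)
qed

lemma fox_sum: "w \<in> carrier F3 \<Longrightarrow> (\<Sum>k\<in>{1, 2, 3}. fox t w k * (t k - 1)) = weight t w - 1"
proof (induction w)
  case (Cons l w)
  have l: "fst l \<in> {1, 2, 3}" and w: "w \<in> carrier F3"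
    using Cons.prems by (auto simp: carrier_free_group dest: reduced_ConsD)
  have "(\<Sum>k\<in>{1, 2, 3}. fox t (l # w) k * (t k - 1))
     = (\<Sum>k\<in>{1, 2, 3}. foxlet t l k * (t k - 1)) + wlet t l * (\<Sum>k\<in>{1, 2, 3}. fox t w k * (t k - 1))"
    by (simp add: algebra_simps)
  also have "(\<Sum>k\<in>{1, 2, 3}. foxlet t l k * (t k - 1)) = wlet t l - 1"
    using l t0[of "fst l"] by (auto simp: foxlet_def wlet_def algebra_simps)
  finally have "(\<Sum>k\<in>{1, 2, 3}. fox t (l # w) k * (t k - 1)) = wlet t l - 1 + wlet t l * (weight t w - 1)"
    using Cons.IH[OF w] by (simp only:)
  then show ?case by (simp add: algebra_simps)
qed simp

lemma fox_Cb3: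
  assumes \<phi>: "\<phi> \<in> carrier Cb3" and "w \<in> carrier F3"
  shows "weight t (\<phi> w) = weight t w \<and>
    fox t (\<phi> w) k = (\<Sum>j\<in>{1, 2, 3}. fox t w j * fox t (\<phi> (gen j)) k)"
proof -
  interpret p: group_hom F3 F3 \<phi> by (rule Cb3_hom[OF \<phi>])
  show ?thesis using assms(2)
  proof (induction w)
    case Nil
    then show ?case using p.hom_one by (simp add: one_free_group)
  next
    case (Cons l w)
    obtain a b where l: "l = (a, b)" by force
    have a: "a \<in> {1, 2, 3}" and w: "w \<in> carrier F3"
      using Cons.prems l by (auto simp: carrier_free_group dest: reduced_ConsD)
    have lc: "[l] \<in> carrier F3" using a l by (simp add: carrier_free_group)
    note ga = gen_closed[OF a]
    have fl: "\<phi> [l] = (if b then \<phi> (gen a) else inv\<^bsub>F3\<^esub> (\<phi> (gen a)))"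
      using l inv_gen[OF a] p.hom_inv[OF ga] by (simp add: gen_def)
    have 1: "weight t (\<phi> [l]) = wlet t l"
      using weight_Cb3_gen[OF \<phi> a] ga unfolding fl
      by (simp add: weight_inv wlet_def l del: p.hom_inv)
    have 2: "fox t (\<phi> [l]) k = (\<Sum>j\<in>{1, 2, 3}. foxlet t l j * fox t (\<phi> (gen j)) k)"
      using a weight_Cb3_gen[OF \<phi> a] ga unfolding fl
      by (auto simp: fox_inv foxlet_def l weight_Cb3_gen[OF \<phi>] simp del: p.hom_inv)
    have "l # w = [l] \<otimes>\<^bsub>F3\<^esub> w"
      using Cons.prems by (simp add: free_group_simps lcons_reduced)
    then have "\<phi> (l # w) = \<phi> [l] \<otimes>\<^bsub>F3\<^esub> \<phi> w" using lc w by simp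
    then show ?case
      using Cons.IH[OF w] 1 2 by (simp add: weight_mult fox_mult algebra_simps)
  qed
qed

lemma phi_hat_entry_mult:
  assumes \<phi>: "\<phi> \<in> carrier Cb3" and \<psi>: "\<psi> \<in> carrier Cb3" and i: "i \<in> {1, 2, 3}"
  shows "phi_hat_entry t (\<phi> \<otimes>\<^bsub>Cb3\<^esub> \<psi>) i k =
    phi_hat_entry t \<phi> i 1 * phi_hat_entry t \<psi> 1 k + phi_hat_entry t \<phi> i 2 * phi_hat_entry t \<psi> 2 k"
proof -
  interpret p: group_hom F3 F3 \<phi> by (rule Cb3_hom[OF \<phi>])
  define M where "M l j = fox t (\<phi> (gen l)) j" for l j
  define N where "N l j = fox t (\<psi> (gen l)) j" for l j
  define u where "u l = (t l - 1) / (t 3 - 1)" for l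
  have comp: "fox t ((\<phi> \<otimes>\<^bsub>Cb3\<^esub> \<psi>) (gen l)) k = M l 1 * N 1 k + M l 2 * N 2 k + M l 3 * N 3 k"
    if l: "l \<in> {1, 2, 3}" for l
    using fox_Cb3[OF \<psi>, of "\<phi> (gen l)" k] gen_closed[OF l]
    by (simp add: Cb3_mult compose_def M_def N_def)
  have row: "M l 1 * u 1 + M l 2 * u 2 + M l 3 = u l" if l: "l \<in> {1, 2, 3}" for l
  proof -
    have "M l 1 * (t 1 - 1) + M l 2 * (t 2 - 1) + M l 3 * (t 3 - 1) = t l - 1"
      using fox_sum[of "\<phi> (gen l)"] weight_Cb3_gen[OF \<phi> l] gen_closed[OF l]
      by (simp add: M_def add.assoc)
    then have "(M l 1 * (t 1 - 1) + M l 2 * (t 2 - 1) + M l 3 * (t 3 - 1)) / (t 3 - 1) = u l"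
      by (simp add: u_def)
    then show ?thesis using t3 by (simp add: u_def add_divide_distrib)
  qed
  have u3: "u 3 = 1" using t3 by (simp add: u_def)
  have M3: "M l 3 = u l - M l 1 * u 1 - M l 2 * u 2" if "l \<in> {1, 2, 3}" for l
    using row[OF that] by (simp add: algebra_simps)
  have three: "(3::nat) \<in> {1, 2, 3}" by simp
  have "phi_hat_entry t (\<phi> \<otimes>\<^bsub>Cb3\<^esub> \<psi>) i k =
      (M i 1 * N 1 k + M i 2 * N 2 k + M i 3 * N 3 k)
      - (M 3 1 * N 1 k + M 3 2 * N 2 k + M 3 3 * N 3 k) * u i"
    using comp[OF i] comp[OF three] by (simp add: phi_hat_entry_def u_def)
  also have "\<dots> = (M i 1 - M 3 1 * u i) * (N 1 k - N 3 k * u 1)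
      + (M i 2 - M 3 2 * u i) * (N 2 k - N 3 k * u 2)"
    unfolding M3[OF i] M3[OF three] u3 by (simp add: algebra_simps)
  finally show ?thesis by (simp add: phi_hat_entry_def M_def N_def u_def)
qed

lemma phi_hat_matrix_mult:
  assumes "\<phi> \<in> carrier Cb3" "\<psi> \<in> carrier Cb3"
  shows "phi_hat_matrix t (\<phi> \<otimes>\<^bsub>Cb3\<^esub> \<psi>) = phi_hat_matrix t \<phi> ** phi_hat_matrix t \<psi>"
  using phi_hat_entry_mult[OF assms, of 1] phi_hat_entry_mult[OF assms, of 2]
  by (simp add: phi_hat_matrix_def mat22_mult)

lemma phi_hat_matrix_hom: "phi_hat_matrix t \<in> hom Cb3 GL"
proof (rule homI)
  interpret C: group Cb3 by (rule group_Cb3)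
  fix \<phi> assume \<phi>: "\<phi> \<in> carrier Cb3"
  have g: "gen 1 \<in> carrier F3" "gen 2 \<in> carrier F3" "gen 3 \<in> carrier F3"
    by (rule gen_closed; simp)+
  have one: "phi_hat_matrix t \<one>\<^bsub>Cb3\<^esub> = mat 1"
    using g by (simp add: phi_hat_matrix_def phi_hat_entry_def Cb3_one mat22_one)
  have "phi_hat_matrix t \<phi> ** phi_hat_matrix t (inv\<^bsub>Cb3\<^esub> \<phi>) = mat 1"
    "phi_hat_matrix t (inv\<^bsub>Cb3\<^esub> \<phi>) ** phi_hat_matrix t \<phi> = mat 1"
    using phi_hat_matrix_mult[OF \<phi> C.inv_closed[OF \<phi>]]
      phi_hat_matrix_mult[OF C.inv_closed[OF \<phi>] \<phi>] \<phi> one by simp_all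
  then show "phi_hat_matrix t \<phi> \<in> carrier GL" by (auto simp: GL_def invertible_def)
qed (simp add: phi_hat_matrix_mult GL_def)

lemma fox_eps:
  assumes ij: "i \<in> {1, 2, 3}" "j \<in> {1, 2, 3}" "i \<noteq> j" and l: "l \<in> {1, 2, 3}"
  shows "fox t (eps i j (gen l)) k =
    (if l = i then (if k = i then inverse (t j) else if k = j then inverse (t j) * (t i - 1) else 0)
     else if k = l then 1 else 0)"
  using gen_closed[OF ij(1)] gen_closed[OF ij(2)] ij(3)
  by (auto simp: eps_gen[OF ij(1,2) l] fox_mult fox_inv weight_mult weight_inv algebra_simps)

lemma is_phi_hat_matrix: "is_phi_hat (t 1) (t 2) (t 3) (phi_hat_matrix t)"
proof -
  have "1 - inverse (t a) * (t a - 1) = inverse (t a)" for a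
    using t0[of a] by (simp add: right_diff_distrib)
  then show ?thesis
    unfolding is_phi_hat_def using phi_hat_matrix_hom t3 t0
    by (simp add: phi_hat_matrix_def phi_hat_entry_def fox_eps)
qed

end

lemma is_phi_hat_phi_hat:
  assumes "t1 \<noteq> 0" "t2 \<noteq> 0" "t3 \<noteq> 0" "t3 \<noteq> 1"
  shows "is_phi_hat t1 t2 t3 (phi_hat t1 t2 t3)"
proof -
  define t :: "nat \<Rightarrow> complex" where "t = (\<lambda>k. if k = 1 then t1 else if k = 2 then t2 else t3)"
  have "is_phi_hat t1 t2 t3 (phi_hat_matrix t)"
    using is_phi_hat_matrix[of t] assms by (simp add: t_def split: if_splits)
  then show ?thesis unfolding phi_hat_def by (rule someI[of "is_phi_hat t1 t2 t3"])
qed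

declare One_nat_def [simp]

end

theory Submission
  imports Defs
begin

text \<open>
  If the two parameter vectors agree, the representation is a tensor square, and the symmetric
  tensors form a proper invariant subspace.

  For the converse the generators enter only through their matrices. Since \<open>\<epsilon>\<^sub>1\<^sub>2 \<epsilon>\<^sub>3\<^sub>2\<close>,
  \<open>\<epsilon>\<^sub>2\<^sub>1 \<epsilon>\<^sub>3\<^sub>1\<close> and \<open>\<epsilon>\<^sub>1\<^sub>3 \<epsilon>\<^sub>2\<^sub>3\<close> act as scalars, \<open>\<epsilon>\<^sub>1\<^sub>2 \<epsilon>\<^sub>1\<^sub>3 \<epsilon>\<^sub>3\<^sub>2 \<epsilon>\<^sub>2\<^sub>3\<close> acts on each factor
  as a nonzero multiple of the commutator of an upper triangular and a diagonal matrix, that is,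
  of an upper unipotent matrix, which is not the identity because the parameters differ from 1.
  In the same way \<open>\<epsilon>\<^sub>2\<^sub>1 \<epsilon>\<^sub>1\<^sub>3 \<epsilon>\<^sub>3\<^sub>1 \<epsilon>\<^sub>2\<^sub>3\<close> gives nontrivial lower unipotent matrices.

  Let \<open>W\<close> be invariant, neither zero nor the whole space. Nilpotency of the unipotent matrices
  minus the identity forces one of two shapes: either \<open>W\<close> contains \<open>e\<^sub>1 \<otimes> e\<^sub>1\<close>, and then also
  \<open>e\<^sub>2 \<otimes> e\<^sub>2\<close> and a combination of \<open>e\<^sub>1 \<otimes> e\<^sub>2\<close> and \<open>e\<^sub>2 \<otimes> e\<^sub>1\<close> with nonzero coefficients, or \<open>W\<close> is
  a line spanned by such a combination (\<open>corner_or_line\<close>). These are the analogues of the symmetric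
  and of the antisymmetric tensors. A triangular pair with diagonals \<open>(a, d)\<close> and \<open>(a', d')\<close>
  multiplies the coefficients of \<open>e\<^sub>1 \<otimes> e\<^sub>2\<close> and \<open>e\<^sub>2 \<otimes> e\<^sub>1\<close> in such a combination by \<open>a d'\<close> and
  \<open>d a'\<close>, so in both cases invariance needs \<open>a d' = d a'\<close> (\<open>proper_invariant_diagonals\<close>). For
  \<open>\<epsilon>\<^sub>2\<^sub>1\<close>, \<open>\<epsilon>\<^sub>1\<^sub>2\<close> and \<open>\<epsilon>\<^sub>1\<^sub>3\<close> this says that the first, second and third parameters agree.
\<close>

section \<open>Coordinates on the tensor product\<close>

text \<open>The coefficients are those of \<open>e\<^sub>1 \<otimes> e\<^sub>1\<close>, \<open>e\<^sub>1 \<otimes> e\<^sub>2\<close>, \<open>e\<^sub>2 \<otimes> e\<^sub>1\<close>, \<open>e\<^sub>2 \<otimes> e\<^sub>2\<close>, in this order.\<close>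

definition tensor :: "complex \<Rightarrow> complex \<Rightarrow> complex \<Rightarrow> complex \<Rightarrow> complex ^ (2 \<times> 2)" where
  "tensor p q r s = (\<chi> k. mat22 p q r s $ fst k $ snd k)"

lemma mat22_nth [simp]:
  "mat22 a b c d $ 1 $ 1 = a" "mat22 a b c d $ 1 $ 2 = b"
  "mat22 a b c d $ 2 $ 1 = c" "mat22 a b c d $ 2 $ 2 = d"
  by (simp_all add: mat22_def)

lemma tensor_nth [simp]:
  "tensor p q r s $ (1, 1) = p" "tensor p q r s $ (1, 2) = q"
  "tensor p q r s $ (2, 1) = r" "tensor p q r s $ (2, 2) = s"
  by (simp_all add: tensor_def)

lemma tensor_vec_eq_iff:
  fixes v w :: "complex ^ (2 \<times> 2)"
  shows "v = w \<longleftrightarrow> v $ (1, 1) = w $ (1, 1) \<and> v $ (1, 2) = w $ (1, 2) \<and>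
    v $ (2, 1) = w $ (2, 1) \<and> v $ (2, 2) = w $ (2, 2)"
  by (auto simp: vec_eq_iff forall_2)

lemma tensor_cases:
  fixes w :: "complex ^ (2 \<times> 2)"
  obtains p q r s where "w = tensor p q r s"
  using that[of "w $ (1, 1)" "w $ (1, 2)" "w $ (2, 1)" "w $ (2, 2)"]
  by (simp add: tensor_vec_eq_iff)

lemma tensor_arith:
  "tensor p q r s + tensor p' q' r' s' = tensor (p + p') (q + q') (r + r') (s + s')"
  "tensor p q r s - tensor p' q' r' s' = tensor (p - p') (q - q') (r - r') (s - s')"
  "k *s tensor p q r s = tensor (k * p) (k * q) (k * r) (k * s)"
  "(0 :: complex ^ (2 \<times> 2)) = tensor 0 0 0 0"
  "tensor p q r s = tensor p' q' r' s' \<longleftrightarrow> p = p' \<and> q = q' \<and> r = r' \<and> s = s'"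
  by (simp_all add: tensor_vec_eq_iff)

lemma sum_UNIV_2_2: "(\<Sum>k\<in>UNIV. f k) = f (1, 1) + f (1, 2) + f (2, 1) + f (2, 2)"
  for f :: "2 \<times> 2 \<Rightarrow> complex"
proof -
  have "(\<Sum>k\<in>UNIV. f k) = (\<Sum>i\<in>UNIV. \<Sum>j\<in>UNIV. f (i, j))"
    unfolding UNIV_Times_UNIV[symmetric] sum.cartesian_product by simp
  then show ?thesis by (simp add: sum_2 add.assoc)
qed

lemma kronecker_nth:
  fixes A B :: "complex ^ 2 ^ 2"
  shows "(kronecker A B *v w) $ (i, j) =
    A $ i $ 1 * B $ j $ 1 * w $ (1, 1) + A $ i $ 1 * B $ j $ 2 * w $ (1, 2) +
    A $ i $ 2 * B $ j $ 1 * w $ (2, 1) + A $ i $ 2 * B $ j $ 2 * w $ (2, 2)"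
  by (simp add: matrix_vector_mult_def kronecker_def sum_UNIV_2_2)

lemma kronecker_mat22_tensor:
  "kronecker (mat22 a b c d) (mat22 a' b' c' d') *v tensor p q r s = tensor
     (a * a' * p + a * b' * q + b * a' * r + b * b' * s)
     (a * c' * p + a * d' * q + b * c' * r + b * d' * s)
     (c * a' * p + c * b' * q + d * a' * r + d * b' * s)
     (c * c' * p + c * d' * q + d * c' * r + d * d' * s)"
  by (simp add: tensor_vec_eq_iff kronecker_nth)

lemma kronecker_mult:
  fixes A A' B B' :: "complex ^ 2 ^ 2"
  shows "kronecker A B *v (kronecker A' B' *v w) = kronecker (A ** A') (B ** B') *v w"
  by (simp add: tensor_vec_eq_iff kronecker_nth matrix_matrix_mult_def sum_2 algebra_simps)

lemma kronecker_scaled: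
  "kronecker (mat22 (k * a) (k * b) (k * c) (k * d)) (mat22 (l * a') (l * b') (l * c') (l * d')) *v w =
   (k * l) *s (kronecker (mat22 a b c d) (mat22 a' b' c' d') *v w)"
  by (simp add: tensor_vec_eq_iff kronecker_nth algebra_simps)

definition stable :: "(complex ^ (2 \<times> 2)) set \<Rightarrow> complex ^ 2 ^ 2 \<Rightarrow> complex ^ 2 ^ 2 \<Rightarrow> bool" where
  "stable W A B \<longleftrightarrow> (\<forall>w\<in>W. kronecker A B *v w \<in> W)"

lemma stable_mult: "stable W A B \<Longrightarrow> stable W A' B' \<Longrightarrow> stable W (A ** A') (B ** B')"
  by (simp add: stable_def flip: kronecker_mult)

lemma stable_scaledD:
  assumes W: "vec.subspace W" and kl: "k \<noteq> 0" "l \<noteq> 0"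
    and st: "stable W (mat22 (k * a) (k * b) (k * c) (k * d)) (mat22 (l * a') (l * b') (l * c') (l * d'))"
  shows "stable W (mat22 a b c d) (mat22 a' b' c' d')"
  unfolding stable_def
proof
  fix w assume "w \<in> W"
  then have "(k * l) *s (kronecker (mat22 a b c d) (mat22 a' b' c' d') *v w) \<in> W"
    using st by (simp add: stable_def kronecker_scaled)
  from vec.subspace_scale[OF W this, of "inverse (k * l)"]
  show "kronecker (mat22 a b c d) (mat22 a' b' c' d') *v w \<in> W"
    using kl by (simp add: field_simps)
qed

section \<open>Subspaces preserved by opposite unipotent pairs\<close>

locale unipotent_stable =
  fixes W :: "(complex ^ (2 \<times> 2)) set" and x x' y y' :: complex
  assumes W: "vec.subspace W" and nonzero: "W \<noteq> {0}"
    and xy: "x \<noteq> 0" "x' \<noteq> 0" "y \<noteq> 0" "y' \<noteq> 0"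
    and upper: "stable W (mat22 1 x 0 1) (mat22 1 x' 0 1)"
    and lower: "stable W (mat22 1 0 y 1) (mat22 1 0 y' 1)"
begin

lemma scaled_mem:
  assumes "tensor (k * p) (k * q) (k * r) (k * s) \<in> W" "k \<noteq> 0"
  shows "tensor p q r s \<in> W"
  using vec.subspace_scale[OF W assms(1), of "inverse k"] assms(2)
  by (simp add: tensor_arith flip: mult.assoc)

text \<open>A subspace preserved by a unipotent operator is preserved by that operator minus the identity,
  which is nilpotent: \<open>ascend\<close> moves coefficients towards \<open>e\<^sub>1 \<otimes> e\<^sub>1\<close>, \<open>descend\<close> towards
  \<open>e\<^sub>2 \<otimes> e\<^sub>2\<close>. Applied twice, each leaves a nonzero multiple of that corner whenever the opposite
  coefficient was nonzero.\<close>

lemma ascend: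
  assumes "tensor p q r s \<in> W"
  shows "tensor (x' * q + x * r + x * x' * s) (x * s) (x' * s) 0 \<in> W"
proof -
  have "kronecker (mat22 1 x 0 1) (mat22 1 x' 0 1) *v tensor p q r s - tensor p q r s \<in> W"
    using upper assms by (intro vec.subspace_diff[OF W]) (auto simp: stable_def)
  then show ?thesis by (simp add: kronecker_mat22_tensor tensor_arith algebra_simps)
qed

lemma descend:
  assumes "tensor p q r s \<in> W"
  shows "tensor 0 (y' * p) (y * p) (y * q + y' * r + y * y' * p) \<in> W"
proof -
  have "kronecker (mat22 1 0 y 1) (mat22 1 0 y' 1) *v tensor p q r s - tensor p q r s \<in> W"
    using lower assms by (intro vec.subspace_diff[OF W]) (auto simp: stable_def)
  then show ?thesis by (simp add: kronecker_mat22_tensor tensor_arith algebra_simps)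
qed

lemma corner11_if:
  assumes "tensor p q r s \<in> W" "s \<noteq> 0"
  shows "tensor 1 0 0 0 \<in> W"
proof (rule scaled_mem)
  show "tensor (2 * x * x' * s * 1) (2 * x * x' * s * 0) (2 * x * x' * s * 0) (2 * x * x' * s * 0) \<in> W"
    using ascend[OF ascend[OF assms(1)]] by (simp add: mult_ac)
qed (use assms(2) xy in simp)

lemma corner22_if:
  assumes "tensor p q r s \<in> W" "p \<noteq> 0"
  shows "tensor 0 0 0 1 \<in> W"
proof (rule scaled_mem)
  show "tensor (2 * y * y' * p * 0) (2 * y * y' * p * 0) (2 * y * y' * p * 0) (2 * y * y' * p * 1) \<in> W"
    using descend[OF descend[OF assms(1)]] by (simp add: mult_ac)
qed (use assms(2) xy in simp)

text \<open>If \<open>W\<close> misses \<open>e\<^sub>1 \<otimes> e\<^sub>1\<close>, it misses \<open>e\<^sub>2 \<otimes> e\<^sub>2\<close> as well, so no vector of \<open>W\<close> has outer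
  coefficients; then \<open>ascend\<close> yields a multiple of \<open>e\<^sub>1 \<otimes> e\<^sub>1\<close>, whose factor must vanish.\<close>

lemma corner_or_line:
  "(tensor 1 0 0 0 \<in> W \<and> tensor 0 0 0 1 \<in> W \<and> tensor 0 y' y 0 \<in> W) \<or>
   (\<forall>p q r s. tensor p q r s \<in> W \<longrightarrow> p = 0 \<and> s = 0 \<and> x' * q + x * r = 0)"
proof (cases "tensor 1 0 0 0 \<in> W")
  case True
  have e22: "tensor 0 0 0 1 \<in> W" using corner22_if[OF True] by simp
  have "tensor 0 y' y (y * y') - (y * y') *s tensor 0 0 0 1 \<in> W"
    using descend[OF True] e22
    by (intro vec.subspace_diff[OF W] vec.subspace_scale[OF W]) simp_all
  then show ?thesis using True e22 by (simp add: tensor_arith)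
next
  case False
  have "p = 0 \<and> s = 0 \<and> x' * q + x * r = 0" if w: "tensor p q r s \<in> W" for p q r s
  proof -
    have s: "s = 0" using corner11_if[OF w] False by blast
    have p: "p = 0" using corner22_if[OF w] corner11_if[of 0 0 0 1] False by fastforce
    have "tensor (x' * q + x * r) 0 0 0 \<in> W" using ascend[OF w] s by simp
    then have "x' * q + x * r = 0"
      using scaled_mem[of "x' * q + x * r" 1 0 0 0] False by auto
    with s p show ?thesis by blast
  qed
  then show ?thesis by blast
qed

lemma whole_space_if:
  assumes e: "tensor 1 0 0 0 \<in> W" "tensor 0 0 0 1 \<in> W" "tensor 0 y' y 0 \<in> W"
    and w: "tensor p q r s \<in> W" "y * q \<noteq> y' * r"
  shows "W = UNIV"
proof -
  have "tensor p1 q1 r1 s1 \<in> W" for p1 q1 r1 s1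
  proof -
    \<comment> \<open>Cramer's rule for the middle coordinates; the corners then absorb the outer ones.\<close>
    define k where "k = (y * q1 - y' * r1) / (y * q - y' * r)"
    define l where "l = (r1 - k * r) / y"
    have "k * (y * q - y' * r) = y * q1 - y' * r1" using w(2) by (simp add: k_def)
    then have "y * (k * q + l * y') = y * q1"
      using xy by (simp add: l_def field_simps)
    then have q1: "q1 = k * q + l * y'" using xy by simp
    have r1: "r1 = k * r + l * y" using xy by (simp add: l_def)
    have "k *s tensor p q r s + l *s tensor 0 y' y 0
        + (p1 - k * p) *s tensor 1 0 0 0 + (s1 - k * s) *s tensor 0 0 0 1 \<in> W"
      using e w(1) by (intro vec.subspace_add[OF W] vec.subspace_scale[OF W])
    then show ?thesis by (simp add: tensor_arith q1 r1)
  qed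
  then show ?thesis by (metis UNIV_eq_I tensor_cases)
qed

text \<open>Triangularity of the pair is what makes it act diagonally on the coefficients of
  \<open>e\<^sub>1 \<otimes> e\<^sub>2\<close> and \<open>e\<^sub>2 \<otimes> e\<^sub>1\<close> of a vector without outer coefficients. A proper \<open>W\<close> allows only
  one ratio of these coefficients, and the two scaling factors must therefore be equal.\<close>

lemma proper_invariant_diagonals:
  assumes proper: "W \<noteq> UNIV"
    and st: "stable W (mat22 a b c d) (mat22 a' b' c' d')"
    and triangular: "b = 0 \<and> b' = 0 \<or> c = 0 \<and> c' = 0"
  shows "a * d' = d * a'"
proof -
  have image: "\<exists>p s. tensor p (a * d' * q) (d * a' * r) s \<in> W" if "tensor 0 q r 0 \<in> W" for q r
  proof -
    have "kronecker (mat22 a b c d) (mat22 a' b' c' d') *v tensor 0 q r 0 \<in> W"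
      using st that by (simp add: stable_def)
    moreover have "b * c' = 0" "c * b' = 0" using triangular by auto
    ultimately show ?thesis by (auto simp: kronecker_mat22_tensor)
  qed
  from corner_or_line show ?thesis
  proof
    assume e: "tensor 1 0 0 0 \<in> W \<and> tensor 0 0 0 1 \<in> W \<and> tensor 0 y' y 0 \<in> W"
    then obtain p s where w: "tensor p (a * d' * y') (d * a' * y) s \<in> W" using image by blast
    have "y * (a * d' * y') = y' * (d * a' * y)"
      using whole_space_if[OF _ _ _ w] e proper by blast
    then show ?thesis using xy by (simp add: mult.commute mult.left_commute)
  next
    assume line: "\<forall>p q r s. tensor p q r s \<in> W \<longrightarrow> p = 0 \<and> s = 0 \<and> x' * q + x * r = 0"
    obtain w where "w \<in> W" "w \<noteq> 0" using nonzero vec.subspace_0[OF W] by blast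
    moreover obtain p q r s where "w = tensor p q r s" by (rule tensor_cases)
    ultimately have qr: "tensor 0 q r 0 \<in> W" "q \<noteq> 0 \<or> r \<noteq> 0" "x' * q + x * r = 0"
      using line by (auto simp: tensor_arith)
    have q: "q \<noteq> 0" using qr(2,3) xy by auto
    from image[OF qr(1)] line have "x' * (a * d' * q) + x * (d * a' * r) = 0" by blast
    moreover have "x * r = - (x' * q)" using qr(3) by (simp add: eq_neg_iff_add_eq_0 add.commute)
    then have "x * (d * a' * r) = - (d * a' * (x' * q))"
      by (metis mult.left_commute mult_minus_right)
    ultimately have "(a * d' - d * a') * (x' * q) = 0" by (simp add: algebra_simps)
    then show ?thesis using xy q by simp
  qed
qed

end

section \<open>The generators of the representation\<close>

lemma is_phi_hat_eps:
  assumes "is_phi_hat t1 t2 t3 \<rho>"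
  shows "\<rho> (eps 1 2) = mat22 (inverse t2) (inverse t2 * (t1 - 1)) 0 1"
    "\<rho> (eps 2 1) = mat22 1 0 (inverse t1 * (t2 - 1)) (inverse t1)"
    "\<rho> (eps 1 3) = mat22 (inverse t3) 0 0 1"
    "\<rho> (eps 3 1) = mat22 (inverse t1) 0 (- inverse t1 * (t2 - 1)) 1"
    "\<rho> (eps 3 2) = mat22 1 (- inverse t2 * (t1 - 1)) 0 (inverse t2)"
    "\<rho> (eps 2 3) = mat22 1 0 0 (inverse t3)"
  using assms unfolding is_phi_hat_def by blast+

text \<open>The third and fourth matrices are scalar multiples of the inverses of the first and second, so
  the product is a commutator up to the scalar \<open>k\<close>. The entries \<open>k * 1\<close> and \<open>k * 0\<close> are left
  unsimplified to exhibit this scalar.\<close>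

lemma mat22_upper_commutator:
  fixes t1 t2 t3 :: complex
  defines "k \<equiv> inverse t2 * inverse t3"
  shows "mat22 (inverse t2) (inverse t2 * (t1 - 1)) 0 1 ** mat22 (inverse t3) 0 0 1 **
      mat22 1 (- inverse t2 * (t1 - 1)) 0 (inverse t2) ** mat22 1 0 0 (inverse t3) =
    mat22 (k * 1) (k * (inverse t2 * (t1 - 1) * (1 - inverse t3))) (k * 0) (k * 1)"
  by (simp add: mat22_mult k_def algebra_simps)

lemma mat22_lower_commutator:
  fixes t1 t2 t3 :: complex
  assumes "t3 \<noteq> 0"
  defines "k \<equiv> inverse t1 * inverse t3"
  shows "mat22 1 0 (inverse t1 * (t2 - 1)) (inverse t1) ** mat22 (inverse t3) 0 0 1 **
      mat22 (inverse t1) 0 (- inverse t1 * (t2 - 1)) 1 ** mat22 1 0 0 (inverse t3) =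
    mat22 (k * 1) (k * 0) (k * (inverse t1 * (t2 - 1) * (1 - t3))) (k * 1)"
proof -
  have "inverse t1 * inverse t3 * (q * (1 - t3)) = q * inverse t3 * inverse t1 - inverse t1 * q" for q
  proof -
    have "inverse t1 * inverse t3 * (q * (1 - t3)) =
        q * inverse t3 * inverse t1 - inverse t1 * q * (inverse t3 * t3)"
      by (simp only: algebra_simps mult_1_left)
    then show ?thesis using assms(1) by simp
  qed
  then show ?thesis by (simp add: mat22_mult k_def mult.commute[of "inverse t3"])
qed

lemma tensor_square_reducible:
  fixes \<rho> :: "'g \<Rightarrow> complex ^ 2 ^ 2"
  shows "\<not> irreducible_rep G (tensor_rep \<rho> \<rho>)"
proof -
  define W :: "(complex ^ (2 \<times> 2)) set" where "W = {w. w $ (1, 2) = w $ (2, 1)}"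
  have "vec.subspace W" by (auto simp: W_def vec.subspace_def)
  moreover have "tensor_rep \<rho> \<rho> g *v w \<in> W" if "w \<in> W" for g w
    using that by (simp add: W_def tensor_rep_def kronecker_nth algebra_simps)
  moreover have "tensor 1 0 0 0 \<in> W" "tensor 0 1 0 0 \<notin> W" by (simp_all add: W_def)
  then have "W \<noteq> {0}" "W \<noteq> UNIV" by (auto simp: tensor_arith)
  ultimately show ?thesis unfolding irreducible_rep_def by blast
qed

theorem theorem8:
  fixes t1 t2 t3 m1 m2 m3 :: complex
  assumes "t1 \<noteq> 0" "t2 \<noteq> 0" "t3 \<noteq> 0" "m1 \<noteq> 0" "m2 \<noteq> 0" "m3 \<noteq> 0"
    and "t1 \<noteq> 1" "t2 \<noteq> 1" "t3 \<noteq> 1" "m1 \<noteq> 1" "m2 \<noteq> 1" "m3 \<noteq> 1"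
  shows "irreducible_rep Cb3 (tensor_rep (phi_hat t1 t2 t3) (phi_hat m1 m2 m3))
    \<longleftrightarrow> (t1, t2, t3) \<noteq> (m1, m2, m3)"
proof
  assume "irreducible_rep Cb3 (tensor_rep (phi_hat t1 t2 t3) (phi_hat m1 m2 m3))"
  then show "(t1, t2, t3) \<noteq> (m1, m2, m3)" using tensor_square_reducible by auto
next
  assume distinct: "(t1, t2, t3) \<noteq> (m1, m2, m3)"
  let ?\<rho> = "phi_hat t1 t2 t3" and ?\<sigma> = "phi_hat m1 m2 m3"
  have \<rho>: "is_phi_hat t1 t2 t3 ?\<rho>" and \<sigma>: "is_phi_hat m1 m2 m3 ?\<sigma>"
    using assms by (simp_all add: is_phi_hat_phi_hat)
  note gens = is_phi_hat_eps[OF \<rho>] is_phi_hat_eps[OF \<sigma>]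
  show "irreducible_rep Cb3 (tensor_rep ?\<rho> ?\<sigma>)"
    unfolding irreducible_rep_def
  proof (intro allI impI, elim conjE)
    fix W :: "(complex ^ (2 \<times> 2)) set"
    assume W: "vec.subspace W"
      and inv: "\<forall>g\<in>carrier Cb3. \<forall>w\<in>W. tensor_rep ?\<rho> ?\<sigma> g *v w \<in> W"
    have st: "stable W (?\<rho> (eps i j)) (?\<sigma> (eps i j))"
      if "i \<in> {1, 2, 3}" "j \<in> {1, 2, 3}" "i \<noteq> j" for i j
      using inv eps_Cb3[OF that] by (simp add: stable_def tensor_rep_def)
    have st12: "stable W (?\<rho> (eps 1 2)) (?\<sigma> (eps 1 2))"
      and st21: "stable W (?\<rho> (eps 2 1)) (?\<sigma> (eps 2 1))"
      and st13: "stable W (?\<rho> (eps 1 3)) (?\<sigma> (eps 1 3))"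
      and st31: "stable W (?\<rho> (eps 3 1)) (?\<sigma> (eps 3 1))"
      and st23: "stable W (?\<rho> (eps 2 3)) (?\<sigma> (eps 2 3))"
      and st32: "stable W (?\<rho> (eps 3 2)) (?\<sigma> (eps 3 2))"
      by (rule st; simp)+
    show "W = {0} \<or> W = UNIV"
    proof (rule ccontr)
      assume "\<not> (W = {0} \<or> W = UNIV)"
      then have proper: "W \<noteq> {0}" "W \<noteq> UNIV" by auto
      define x where "x = inverse t2 * (t1 - 1) * (1 - inverse t3)"
      define x' where "x' = inverse m2 * (m1 - 1) * (1 - inverse m3)"
      define y where "y = inverse t1 * (t2 - 1) * (1 - t3)"
      define y' where "y' = inverse m1 * (m2 - 1) * (1 - m3)"
      have "stable W (mat22 1 x 0 1) (mat22 1 x' 0 1)"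
        using stable_mult[OF stable_mult[OF stable_mult[OF st12 st13] st32] st23]
        unfolding gens mat22_upper_commutator
        unfolding x_def x'_def
        by (rule stable_scaledD[OF W, rotated 2]) (use assms in simp_all)
      moreover have "stable W (mat22 1 0 y 1) (mat22 1 0 y' 1)"
        using stable_mult[OF stable_mult[OF stable_mult[OF st21 st13] st31] st23]
        unfolding gens mat22_lower_commutator[OF assms(3)]
          mat22_lower_commutator[OF assms(6)]
        unfolding y_def y'_def
        by (rule stable_scaledD[OF W, rotated 2]) (use assms in simp_all)
      moreover have "x \<noteq> 0" "x' \<noteq> 0" "y \<noteq> 0" "y' \<noteq> 0"
        using assms by (simp_all add: x_def x'_def y_def y'_def)
      ultimately interpret unipotent_stable W x x' y y'
        using W proper by unfold_locales
      note diagonals = proper_invariant_diagonals[OF proper(2)]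
      have "t1 = m1" using diagonals[OF st21[unfolded gens]] by simp
      moreover have "t2 = m2" using diagonals[OF st12[unfolded gens]] by simp
      moreover have "t3 = m3" using diagonals[OF st13[unfolded gens]] by simp
      ultimately show False using distinct by simp
    qed
  qed
qed

end
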